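(* Let $I=\{I^g_m : g\in\Gamma,\ m\in M_g\}$ be a set of deep learning inference requests, where $\Gamma$ is the set of all request categories and, for each $g\in\Gamma$, $M_g$ is the (finite, nonempty) set of all requests in category $g$. Each request $I^g_m$ consists of a series of frames that need to be processed by a GPU, each frame having an arrival time, and each request has a relative deadline $d^g_m>0$. Suppose the frames are batch processed with the time window scheme (defined in the context), where for each category $g\in\Gamma$ the time window length is set to $$W_g=\frac12\min_{m\in M_g} d^g_m .$$ If all the batched job instances (of all categories) produced by the time window scheme are schedulable, i.e. each job instance of category $g$ has latency at most its relative deadline $W_g$, then all requests in $I$ are schedulable, i.e. for every $g\in\Gamma$ and $m\in M_g$, every frame of $I^g_m$ has latency at most $d^g_m$.
   Context: Requests and categories. Each request is a video, i.e. a series of frames arriving over time, to be processed by a specified neural network model. Frames (and requests) with the same frame shape that require the same model are said to be of the same category; only frames of the same category may be batched together. Time window scheme. For each category $g$, time is divided into contiguous intervals ("time windows") of equal length $W_g>0$: there is a starting time $\tau_g\in\mathbb{R}$, no later than the arrival of any frame of category $g$, and the $k$-th window ($k=0,1,2,\dots$) runs from $\tau_g+kW_g$ to $\tau_g+(k+1)W_g$. The end time of one window is the start time of the next. The windows of different categories are independent of each other. Each frame of category $g$ belongs to one window of category $g$ containing its arrival time (a frame arriving exactly at a common endpoint of two consecutive windows is assigned to one of these two windows). All frames of category $g$ that belong to the same window, regardless of which request of category $g$ they come from, are batched into one job instance. This job instance is released at the end of that window, and its relative deadline is $W_g$; that is, it should be completed by the end of the next window. Execution. The job instances are executed on the GPU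 according to some schedule, which gives each job instance a completion time no earlier than its release time. A frame is completed when the job instance containing it is completed. Latency and schedulability. The latency of a job instance is its completion time minus its release time; a job instance is schedulable if its latency is at most its relative deadline. The latency of a frame is its completion time minus its arrival time; a request $I^g_m$ is schedulable if the latency of each of its frames is at most $d^g_m$. *)

theory Defs
  imports Complex_Main "HOL-Library.Extended_Nat"
begin

text \<open>
  The requests of category \<open>g\<close> are named by the elements of \<open>requests I g\<close>.  The frames of a
  request form a finite or infinite series and are numbered from 0; \<open>num_frames\<close> gives the length.
\<close>

record ('g, 'm) request_set =
  categories :: "'g set"
  requests :: "'g \<Rightarrow> 'm set"
  num_frames :: "'g \<Rightarrow> 'm \<Rightarrow> enat"
  arrival :: "'g \<Rightarrow> 'm \<Rightarrow> nat \<Rightarrow> real"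
  deadline :: "'g \<Rightarrow> 'm \<Rightarrow> real"

definition frames :: "('g, 'm) request_set \<Rightarrow> 'g \<Rightarrow> 'm \<Rightarrow> nat set" where
  "frames I g m = {j. enat j < num_frames I g m}"

definition inference_requests :: "('g, 'm) request_set \<Rightarrow> bool" where
  "inference_requests I \<longleftrightarrow>
     (\<forall>g\<in>categories I. finite (requests I g) \<and> requests I g \<noteq> {} \<and>
        (\<forall>m\<in>requests I g. deadline I g m > 0))"

text \<open>
  \<open>window_of S g m j\<close> is the index of the window to which frame \<open>j\<close> of request \<open>m\<close> of category \<open>g\<close>
  is assigned.  It is part of the data because a frame arriving at the common endpoint of two
  windows may be assigned to either of them.
\<close>

record ('g, 'm) window_scheme =
  start_time :: "'g \<Rightarrow> real"
  window_length :: "'g \<Rightarrow> real"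
  window_of :: "'g \<Rightarrow> 'm \<Rightarrow> nat \<Rightarrow> nat"

definition window_start :: "('g, 'm) window_scheme \<Rightarrow> 'g \<Rightarrow> nat \<Rightarrow> real" where
  "window_start S g k = start_time S g + real k * window_length S g"

definition window_end :: "('g, 'm) window_scheme \<Rightarrow> 'g \<Rightarrow> nat \<Rightarrow> real" where
  "window_end S g k = start_time S g + real (k + 1) * window_length S g"

definition time_window_scheme ::
    "('g, 'm) request_set \<Rightarrow> ('g, 'm) window_scheme \<Rightarrow> bool" where
  "time_window_scheme I S \<longleftrightarrow>
     (\<forall>g\<in>categories I. window_length S g > 0 \<and>
        (\<forall>m\<in>requests I g. \<forall>j\<in>frames I g m.
           start_time S g \<le> arrival I g m j \<and>
           arrival I g m j \<in>
             {window_start S g (window_of S g m j)..window_end S g (window_of S g m j)}))"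

definition batch ::
    "('g, 'm) request_set \<Rightarrow> ('g, 'm) window_scheme \<Rightarrow> 'g \<Rightarrow> nat \<Rightarrow> ('m \<times> nat) set" where
  "batch I S g k = {(m, j). m \<in> requests I g \<and> j \<in> frames I g m \<and> window_of S g m j = k}"

text \<open>
  A job instance is identified by its category and window; windows to which no frame is assigned
  produce none.
\<close>

definition job_instances ::
    "('g, 'm) request_set \<Rightarrow> ('g, 'm) window_scheme \<Rightarrow> ('g \<times> nat) set" where
  "job_instances I S = {(g, k). g \<in> categories I \<and> batch I S g k \<noteq> {}}"

definition release_time :: "('g, 'm) window_scheme \<Rightarrow> 'g \<times> nat \<Rightarrow> real" where
  "release_time S = (\<lambda>(g, k). window_end S g k)"

definition relative_deadline :: "('g, 'm) window_scheme \<Rightarrow> 'g \<times> nat \<Rightarrow> real" where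
  "relative_deadline S = (\<lambda>(g, k). window_length S g)"

text \<open>A schedule enters only through the completion times \<open>C\<close> that it gives to the job instances.\<close>

definition completion_times ::
    "('g, 'm) request_set \<Rightarrow> ('g, 'm) window_scheme \<Rightarrow> ('g \<times> nat \<Rightarrow> real) \<Rightarrow> bool" where
  "completion_times I S C \<longleftrightarrow> (\<forall>J\<in>job_instances I S. release_time S J \<le> C J)"

definition job_latency ::
    "('g, 'm) window_scheme \<Rightarrow> ('g \<times> nat \<Rightarrow> real) \<Rightarrow> 'g \<times> nat \<Rightarrow> real" where
  "job_latency S C J = C J - release_time S J"

definition job_schedulable ::
    "('g, 'm) window_scheme \<Rightarrow> ('g \<times> nat \<Rightarrow> real) \<Rightarrow> 'g \<times> nat \<Rightarrow> bool" where
  "job_schedulable S C J \<longleftrightarrow> job_latency S C J \<le> relative_deadline S J"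

definition frame_completion ::
    "('g, 'm) window_scheme \<Rightarrow> ('g \<times> nat \<Rightarrow> real) \<Rightarrow> 'g \<Rightarrow> 'm \<Rightarrow> nat \<Rightarrow> real" where
  "frame_completion S C g m j = C (g, window_of S g m j)"

definition frame_latency ::
    "('g, 'm) request_set \<Rightarrow> ('g, 'm) window_scheme \<Rightarrow> ('g \<times> nat \<Rightarrow> real) \<Rightarrow>
      'g \<Rightarrow> 'm \<Rightarrow> nat \<Rightarrow> real" where
  "frame_latency I S C g m j = frame_completion S C g m j - arrival I g m j"

definition request_schedulable ::
    "('g, 'm) request_set \<Rightarrow> ('g, 'm) window_scheme \<Rightarrow> ('g \<times> nat \<Rightarrow> real) \<Rightarrow>
      'g \<Rightarrow> 'm \<Rightarrow> bool" where
  "request_schedulable I S C g m \<longleftrightarrow>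
     (\<forall>j\<in>frames I g m. frame_latency I S C g m j \<le> deadline I g m)"

end

theory Submission
  imports Defs
begin

text \<open>A frame waits at most one window length \<open>W\<close> until its window closes and its
  job instance is released; schedulability of that job instance adds at most another
  \<open>W\<close>. The latency is thus at most \<open>2 * W\<close>, which is the least deadline in
  the category.\<close>

theorem theorem1:
  fixes I :: "('g, 'm) request_set"
    and S :: "('g, 'm) window_scheme"
    and C :: "'g \<times> nat \<Rightarrow> real"
  assumes "inference_requests I"
    and "time_window_scheme I S"
    and "completion_times I S C"
    and "\<forall>g\<in>categories I. window_length S g = 1 / 2 * Min (deadline I g ` requests I g)"
    and "\<forall>J\<in>job_instances I S. job_schedulable S C J"
  shows "\<forall>g\<in>categories I. \<forall>m\<in>requests I g. request_schedulable I S C g m"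
proof (intro ballI)
  fix g m
  assume g: "g \<in> categories I" and m: "m \<in> requests I g"
  let ?W = "window_length S g"
  \<comment> \<open>Finiteness of \<open>requests I g\<close> makes \<open>Min\<close> a true lower
    bound.\<close>
  have "Min (deadline I g ` requests I g) \<le> deadline I g m"
    using assms(1) g m by (auto simp: inference_requests_def)
  then have W: "2 * ?W \<le> deadline I g m"
    using bspec[OF assms(4) g] by linarith
  show "request_schedulable I S C g m"
    unfolding request_schedulable_def
  proof
    fix j
    assume j: "j \<in> frames I g m"
    let ?k = "window_of S g m j"
    \<comment> \<open>The frame itself witnesses that its batch is nonempty, so the schedulability
      hypothesis covers this window.\<close>
    have "(g, ?k) \<in> job_instances I S"
      using g m j by (auto simp: job_instances_def batch_def)
    then have "C (g, ?k) \<le> window_end S g ?k + ?W"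
      using assms(5)
      by (force simp: job_schedulable_def job_latency_def release_time_def relative_deadline_def)
    \<comment> \<open>The worst case is arrival at the very start of the window. The bound holds for
      either choice of window at a common endpoint.\<close>
    moreover have "window_start S g ?k \<le> arrival I g m j"
      using assms(2) g m j by (auto simp: time_window_scheme_def)
    moreover have "window_end S g ?k = window_start S g ?k + ?W"
      by (simp add: window_end_def window_start_def algebra_simps)
    ultimately show "frame_latency I S C g m j \<le> deadline I g m"
      using W by (simp add: frame_latency_def frame_completion_def)
  qed
qed

end
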